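(* Let $\alpha_1,\dots,\alpha_n,\beta_{n+1},\dots,\beta_m$ be positive integers satisfying $\sum_{i=1}^n\alpha_i=\sum_{j=n+1}^m\beta_j$. Let $\Delta(\alpha,\beta)\subseteq\mathbb R^m$ be the convex hull of the $m+2$ points consisting of the origin, the $m$ standard unit basis vectors of $\mathbb R^m$, and $(\alpha_1,\dots,\alpha_n,-\beta_{n+1},\dots,-\beta_m)$. Then the ratios $$u_k(\alpha,\beta)=\frac{(\alpha_1k)!\cdots(\alpha_nk)!}{(\beta_{n+1}k)!\cdots(\beta_mk)!}$$ are integers for all natural numbers $k$ if and only if the polytope $n\Delta(\alpha,\beta)$ contains no interior lattice points.
   Context: For a polytope $\Delta\subseteq\mathbb R^m$, $n\Delta=\{nx\mid x\in\Delta\}$. An interior lattice point of $n\Delta$ is a point of $\mathbb Z^m$ lying in the topological interior of $n\Delta$ in $\mathbb R^m$. *)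

theory Defs
  imports "HOL-Analysis.Analysis"
begin

text \<open>
  The coordinates of the ambient space are indexed by the disjoint sum \<open>'n + 'p\<close> of the index
  types of the \<open>\<alpha>\<close>s and the \<open>\<beta>\<close>s, so \<open>n = CARD('n)\<close>, \<open>m - n = CARD('p)\<close> and
  \<open>m = CARD('n + 'p)\<close>. Index types are nonempty, i.e. \<open>1 \<le> n < m\<close>. For positive \<open>\<alpha>\<close>, \<open>\<beta>\<close>
  with equal sums this excludes only \<open>n = m = 0\<close>.
\<close>

definition apex :: "('n::finite \<Rightarrow> nat) \<Rightarrow> ('p::finite \<Rightarrow> nat) \<Rightarrow> real ^ ('n + 'p)" where
  "apex \<alpha> \<beta> = (\<chi> l. case l of Inl i \<Rightarrow> real (\<alpha> i) | Inr j \<Rightarrow> - real (\<beta> j))"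

definition Delta_polytope ::
    "('n::finite \<Rightarrow> nat) \<Rightarrow> ('p::finite \<Rightarrow> nat) \<Rightarrow> (real ^ ('n + 'p)) set" where
  "Delta_polytope \<alpha> \<beta> = convex hull ({0} \<union> range (\<lambda>l. axis l 1) \<union> {apex \<alpha> \<beta>})"

definition dilate :: "nat \<Rightarrow> (real ^ 'm::finite) set \<Rightarrow> (real ^ 'm) set" where
  "dilate r S = (\<lambda>x. real r *\<^sub>R x) ` S"

definition lattice_points :: "(real ^ 'm::finite) set" where
  "lattice_points = {x. \<forall>l. x $ l \<in> \<int>}"

definition factorial_ratio ::
    "('n::finite \<Rightarrow> nat) \<Rightarrow> ('p::finite \<Rightarrow> nat) \<Rightarrow> nat \<Rightarrow> rat" where
  "factorial_ratio \<alpha> \<beta> k = (\<Prod>i\<in>UNIV. fact (\<alpha> i * k)) / (\<Prod>j\<in>UNIV. fact (\<beta> j * k))"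

end

(* By Legendre's formula, the ratios are integers iff
   F(x) = sum_i floor(alpha_i x) - sum_j floor(beta_j x) is nonnegative for all real x (Landau): if F(s) < 0
   with 0 < s < 1, then a large prime p divides the denominator to a higher power for some k with k/p slightly above s.
   Writing v for the apex, x is interior to n Delta iff some s > 0 satisfies x > s v coordinatewise
   and (sum of coordinates of x) + s < n. For fixed generic s, the lattice point above s v with the
   least coordinate sum has coordinate sum n + F(s), so an interior lattice point exists iff
   F(s) < -s for some s > 0. As F is integer-valued and 1-periodic, this means that F takes a negative value. *)
theory Submission
  imports Defs "HOL-Computational_Algebra.Primes"
begin

section \<open>Prime multiplicities of products of factorials\<close>

lemma div_Suc_eq_dvd:
  fixes n d :: nat
  assumes "d > 0"
  shows "Suc n div d = n div d + of_bool (d dvd Suc n)"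
  using assms by (auto simp: div_Suc dvd_eq_mod_eq_0)

text \<open>Passing from \<open>n\<close> to \<open>n + 1\<close> raises the quotient by
  \<open>p ^ e\<close> by one exactly when \<open>p ^ e\<close> divides \<open>n + 1\<close>, and
  the number of such \<open>e \<ge> 1\<close> is the multiplicity of \<open>p\<close> in
  \<open>n + 1\<close>. Any bound \<open>N \<ge> n\<close> is allowed, so that different factorials
  can share one range of exponents.\<close>

lemma legendre_fact:
  fixes p :: nat
  assumes p: "prime p" and "n \<le> N"
  shows "multiplicity p (fact n :: nat) = (\<Sum>e=1..N. n div p ^ e)"
  using \<open>n \<le> N\<close>
proof (induction n)
  case 0
  then show ?case by simp
next
  case (Suc n)
  have p1: "p > 1" using p prime_gt_1_nat by blast
  let ?m = "multiplicity p (Suc n)"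
  have dvd_iff: "p ^ e dvd Suc n \<longleftrightarrow> e \<le> ?m" for e
    by (rule power_dvd_iff_le_multiplicity) (use p1 in auto)
  \<comment> \<open>The range \<open>1..N\<close> contains every \<open>e \<ge> 1\<close> with
    \<open>p ^ e\<close> dividing \<open>n + 1\<close>, so cutting the sum off at \<open>N\<close>
    loses nothing.\<close>
  have "?m < p ^ ?m" using p1 by (intro power_gt_expt) simp
  also have "p ^ ?m \<le> Suc n" using dvd_iff[of ?m] dvd_imp_le by blast
  finally have "?m \<le> N" using Suc.prems by simp
  then have "{1..N} \<inter> {e. p ^ e dvd Suc n} = {1..?m}"
    by (auto simp: dvd_iff simp del: fact_Suc)
  then have "(\<Sum>e=1..N. of_bool (p ^ e dvd Suc n)) = ?m"
    by (simp add: sum_of_bool_eq)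
  moreover have "multiplicity p (fact (Suc n) :: nat) = ?m + multiplicity p (fact n :: nat)"
    unfolding fact_Suc using p by (subst prime_elem_multiplicity_mult_distrib) auto
  moreover have "(\<Sum>e=1..N. Suc n div p ^ e)
      = (\<Sum>e=1..N. n div p ^ e) + (\<Sum>e=1..N. of_bool (p ^ e dvd Suc n))"
    using p1 by (simp add: div_Suc_eq_dvd sum.distrib)
  ultimately show ?case using Suc by simp
qed

definition floor_diff :: "('n::finite \<Rightarrow> nat) \<Rightarrow> ('p::finite \<Rightarrow> nat) \<Rightarrow> real \<Rightarrow> int" where
  "floor_diff \<alpha> \<beta> x = (\<Sum>i\<in>UNIV. \<lfloor>real (\<alpha> i) * x\<rfloor>) - (\<Sum>j\<in>UNIV. \<lfloor>real (\<beta> j) * x\<rfloor>)"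

text \<open>Removing the integer part of \<open>x\<close> shifts each floor by a multiple of the
  integer \<open>\<lfloor>x\<rfloor>\<close>, and the shifts cancel because the two sums agree. A
  negative value can therefore be looked for in \<open>[0, 1)\<close>.\<close>

lemma floor_diff_frac:
  assumes "(\<Sum>i\<in>UNIV. \<alpha> i) = (\<Sum>j\<in>UNIV. \<beta> j)"
  shows "floor_diff \<alpha> \<beta> (frac x) = floor_diff \<alpha> \<beta> x"
proof -
  have *: "\<lfloor>real a * frac x\<rfloor> = \<lfloor>real a * x\<rfloor> - int a * \<lfloor>x\<rfloor>" for a
  proof -
    have "real a * frac x = real a * x - of_int (int a * \<lfloor>x\<rfloor>)"
      by (simp add: frac_def algebra_simps)
    then show ?thesis by (metis floor_diff_of_int)
  qed
  have "(\<Sum>i\<in>UNIV. int (\<alpha> i)) = (\<Sum>j\<in>UNIV. int (\<beta> j))"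
    using assms by (metis of_nat_sum)
  then show ?thesis
    by (simp add: floor_diff_def * sum_subtractf flip: sum_distrib_right)
qed

lemma multiplicity_prod_fact:
  fixes p :: nat and \<gamma> :: "'a::finite \<Rightarrow> nat"
  assumes p: "prime p" and N: "\<And>i. \<gamma> i * k \<le> N"
  shows "int (multiplicity p (\<Prod>i\<in>UNIV. fact (\<gamma> i * k) :: nat))
    = (\<Sum>e=1..N. \<Sum>i\<in>UNIV. \<lfloor>real (\<gamma> i) * (real k / real (p ^ e))\<rfloor>)"
proof -
  have "multiplicity p (\<Prod>i\<in>UNIV. fact (\<gamma> i * k) :: nat)
      = (\<Sum>i\<in>UNIV. multiplicity p (fact (\<gamma> i * k) :: nat))"
    using p by (intro prime_elem_multiplicity_prod_distrib) auto
  also have "\<dots> = (\<Sum>i\<in>UNIV. \<Sum>e=1..N. (\<gamma> i * k) div p ^ e)"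
    using legendre_fact[OF p N] by simp
  also have "int \<dots> = (\<Sum>i\<in>UNIV. \<Sum>e=1..N. \<lfloor>real (\<gamma> i * k) / real (p ^ e)\<rfloor>)"
    by (simp only: floor_divide_of_nat_eq of_nat_sum)
  finally show ?thesis
    by (subst sum.swap) simp
qed

text \<open>With one \<open>N\<close> bounding the arguments of all factorials, the Legendre sums of
  numerator and denominator run over the same exponents and combine, exponent by exponent, into
  values of Landau's function at \<open>k / p ^ e\<close>.\<close>

lemma multiplicity_factorial_products:
  fixes p :: nat and \<alpha> :: "'n::finite \<Rightarrow> nat" and \<beta> :: "'p::finite \<Rightarrow> nat"
  assumes p: "prime p"
    and N: "(\<Sum>i\<in>UNIV. \<alpha> i * k) + (\<Sum>j\<in>UNIV. \<beta> j * k) \<le> N"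
  shows "int (multiplicity p (\<Prod>i\<in>UNIV. fact (\<alpha> i * k) :: nat))
      - int (multiplicity p (\<Prod>j\<in>UNIV. fact (\<beta> j * k) :: nat))
    = (\<Sum>e=1..N. floor_diff \<alpha> \<beta> (real k / real (p ^ e)))"
proof -
  have "\<alpha> i * k \<le> N" for i
    using member_le_sum[of i UNIV "\<lambda>i. \<alpha> i * k"] N by simp
  moreover have "\<beta> j * k \<le> N" for j
    using member_le_sum[of j UNIV "\<lambda>j. \<beta> j * k"] N by simp
  ultimately show ?thesis
    by (simp only: multiplicity_prod_fact[OF p, where N = N] floor_diff_def sum_subtractf)
qed

lemma factorial_ratio_in_Ints_iff:
  "factorial_ratio \<alpha> \<beta> k \<in> \<int> \<longleftrightarrow>
    (\<Prod>j\<in>UNIV. fact (\<beta> j * k) :: nat) dvd (\<Prod>i\<in>UNIV. fact (\<alpha> i * k))"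
  (is "_ \<longleftrightarrow> ?B dvd ?A")
proof -
  have B: "?B > 0" by (simp add: prod_pos)
  have eq: "factorial_ratio \<alpha> \<beta> k = of_int (int ?A) / of_int (int ?B)"
    by (simp add: factorial_ratio_def)
  have "factorial_ratio \<alpha> \<beta> k \<in> \<int> \<longleftrightarrow> int ?B dvd int ?A"
  proof
    assume "factorial_ratio \<alpha> \<beta> k \<in> \<int>"
    then obtain z where "factorial_ratio \<alpha> \<beta> k = of_int z" by (elim Ints_cases)
    then have "(of_int (int ?A) :: rat) = of_int (int ?B * z)"
      using B unfolding eq by (simp add: field_simps)
    then have "int ?A = int ?B * z" by (simp only: of_int_eq_iff)
    then show "int ?B dvd int ?A" by simp
  next
    assume "int ?B dvd int ?A"
    then show "factorial_ratio \<alpha> \<beta> k \<in> \<int>"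
      unfolding eq by (rule of_int_divide_in_Ints)
  qed
  then show ?thesis by (simp only: int_dvd_int_iff)
qed

section \<open>One-sided behaviour of floors and Landau's criterion\<close>

lemma eventually_floor_at_right:
  "eventually (\<lambda>t. \<lfloor>real a * t\<rfloor> = \<lfloor>real a * s\<rfloor>) (at_right s)"
proof -
  have "((\<lambda>t. real a * t) \<longlongrightarrow> real a * s) (at_right s)" by (intro tendsto_intros)
  then have "eventually (\<lambda>t. real a * t < of_int \<lfloor>real a * s\<rfloor> + 1) (at_right s)"
    by (rule order_tendstoD) linarith
  moreover have "eventually (\<lambda>t. t > s) (at_right s)" by (rule eventually_at_right_less)
  ultimately show ?thesis
  proof eventually_elim
    case (elim t)
    then have "real a * s \<le> real a * t" by (simp add: mult_left_mono)
    then show ?case using elim by linarith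
  qed
qed

text \<open>Just left of \<open>s\<close>, the product \<open>a * t\<close> lies strictly between
  \<open>\<lceil>a * s\<rceil> - 1\<close> and \<open>a * s\<close>. Strictness on the right needs
  \<open>a > 0\<close>: for \<open>a = 0\<close> the floor is 0, not -1.\<close>

lemma eventually_floor_at_left:
  assumes "a > 0"
  shows "eventually (\<lambda>t. \<lfloor>real a * t\<rfloor> = \<lceil>real a * s\<rceil> - 1) (at_left s)"
proof -
  have "((\<lambda>t. real a * t) \<longlongrightarrow> real a * s) (at_left s)" by (intro tendsto_intros)
  then have "eventually (\<lambda>t. real a * t > of_int \<lceil>real a * s\<rceil> - 1) (at_left s)"
    by (rule order_tendstoD) linarith
  moreover have "eventually (\<lambda>t. t < s) (at_left s)"
    by (simp add: eventually_at_filter)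
  ultimately show ?thesis
  proof eventually_elim
    case (elim t)
    then have "real a * t < real a * s" using assms by simp
    then show ?case using elim by linarith
  qed
qed

text \<open>This leaves room to move a negative value from \<open>s\<close> to a nearby fraction
  \<open>k / p\<close>, or to a point where no \<open>\<beta> j * t\<close> is an integer.\<close>

lemma eventually_floor_diff_at_right:
  "eventually (\<lambda>t. floor_diff \<alpha> \<beta> t = floor_diff \<alpha> \<beta> s) (at_right s)"
proof -
  have "eventually (\<lambda>t. \<forall>i. \<lfloor>real (\<alpha> i) * t\<rfloor> = \<lfloor>real (\<alpha> i) * s\<rfloor>) (at_right s)"
    by (intro eventually_all_finite eventually_floor_at_right)
  moreover have "eventually (\<lambda>t. \<forall>j. \<lfloor>real (\<beta> j) * t\<rfloor> = \<lfloor>real (\<beta> j) * s\<rfloor>) (at_right s)"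
    by (intro eventually_all_finite eventually_floor_at_right)
  ultimately show ?thesis
    by eventually_elim (simp add: floor_diff_def)
qed

text \<open>If the value at \<open>s\<close> is negative, a fraction \<open>k / p\<close> just right
  of \<open>s\<close> makes the exponent 1 contribute a negative amount to the multiplicity of
  \<open>p\<close> in the ratio, while for large \<open>p\<close> all higher exponents contribute
  0.\<close>

lemma factorial_ratio_in_Ints_imp_floor_diff_nonneg:
  assumes sums: "(\<Sum>i\<in>UNIV. \<alpha> i) = (\<Sum>j\<in>UNIV. \<beta> j)"
    and int: "\<And>k. factorial_ratio \<alpha> \<beta> k \<in> \<int>"
  shows "floor_diff \<alpha> \<beta> x \<ge> 0"
proof (rule ccontr)
  define s where "s = frac x"
  assume "\<not> ?thesis"
  then have neg: "floor_diff \<alpha> \<beta> s < 0" by (simp add: s_def floor_diff_frac[OF sums])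
  have s: "0 \<le> s" "s < 1" by (auto simp: s_def frac_lt_1)
  obtain b where b: "b > s" "\<And>t. s < t \<Longrightarrow> t < b \<Longrightarrow> floor_diff \<alpha> \<beta> t = floor_diff \<alpha> \<beta> s"
    using eventually_floor_diff_at_right[of \<alpha> \<beta> s] unfolding eventually_at_right_field by blast
  obtain M where M: "real M > 1 / (b - s)" using reals_Archimedean2 by blast
  define S where "S = (\<Sum>i\<in>UNIV. \<alpha> i)"
  \<comment> \<open>\<open>p > M\<close> gives \<open>1 / p < b - s\<close>, so some multiple of
    \<open>1 / p\<close> falls between \<open>s\<close> and \<open>b\<close>; \<open>p > S\<close>
    makes \<open>p\<close> exceed every \<alpha> and every \<beta>.\<close>
  obtain p :: nat where p: "prime p" "p > M + S" using bigger_prime by blast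
  have p0: "p > 0" using p by simp
  \<comment> \<open>The least integer strictly above \<open>p * s\<close>, so that
    \<open>k / p\<close> lies in the half-open interval from \<open>s\<close> (excluded) to
    \<open>s + 1 / p\<close>.\<close>
  define k where "k = nat (\<lfloor>real p * s\<rfloor> + 1)"
  have rk: "real k = of_int \<lfloor>real p * s\<rfloor> + 1" using s by (simp add: k_def)
  have "real p * s < real k" "real k \<le> real p * s + 1" using rk by linarith+
  moreover have "1 < (b - s) * real p"
  proof -
    have "1 < real M * (b - s)" using M b(1) by (simp add: field_simps)
    also have "\<dots> \<le> real p * (b - s)" using p(2) b(1) by (intro mult_right_mono) auto
    finally show ?thesis by (simp add: mult.commute)
  qed
  ultimately have "s < real k / real p" "real k / real p < b"
    using p0 by (simp_all add: field_simps)
  then have first: "floor_diff \<alpha> \<beta> (real k / real (p ^ 1)) < 0" using b(2) neg by simp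
  have "k \<le> p"
  proof -
    have "real p * s < real p" using s p0 by simp
    then show ?thesis unfolding k_def by linarith
  qed
  \<comment> \<open>Every \<alpha> and \<beta> is at most \<open>S < p\<close>, and
    \<open>k \<le> p\<close>, so all numerators stay below \<open>p * p\<close> and every floor is
    0.\<close>
  have rest: "floor_diff \<alpha> \<beta> (real k / real (p ^ e)) = 0" if "e \<ge> 2" for e
  proof -
    have "\<lfloor>real a * (real k / real (p ^ e))\<rfloor> = 0" if "a \<le> S" for a
    proof -
      have "a * k < p * p" using that p(2) \<open>k \<le> p\<close> p0
        by (intro le_less_trans[OF mult_le_mono2 mult_less_mono1]) auto
      also have "p * p \<le> p ^ e" using power_increasing[OF \<open>e \<ge> 2\<close>, of p] p0
        by (simp add: power2_eq_square)
      finally have "(a * k) div p ^ e = 0" by simp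
      then show ?thesis using floor_divide_of_nat_eq[of "a * k" "p ^ e", where ?'a = real] by simp
    qed
    moreover have "\<alpha> i \<le> S" for i unfolding S_def by (rule member_le_sum) auto
    moreover have "\<beta> j \<le> S" for j unfolding S_def sums by (rule member_le_sum) auto
    ultimately show ?thesis by (simp add: floor_diff_def)
  qed
  \<comment> \<open>The \<open>Suc\<close> ensures \<open>N \<ge> 1\<close>, so that the term
    \<open>e = 1\<close> can be split off.\<close>
  define N where "N = Suc ((\<Sum>i\<in>UNIV. \<alpha> i * k) + (\<Sum>j\<in>UNIV. \<beta> j * k))"
  have "(\<Sum>e=1..N. floor_diff \<alpha> \<beta> (real k / real (p ^ e))) = floor_diff \<alpha> \<beta> (real k / real (p ^ 1))"
    using rest by (subst sum.atLeast_Suc_atMost) (auto simp: N_def intro!: sum.neutral)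
  then have "multiplicity p (\<Prod>i\<in>UNIV. fact (\<alpha> i * k) :: nat)
      < multiplicity p (\<Prod>j\<in>UNIV. fact (\<beta> j * k) :: nat)"
    using multiplicity_factorial_products[OF p(1), of \<alpha> k \<beta> N] first by (simp add: N_def)
  moreover have "multiplicity p (\<Prod>j\<in>UNIV. fact (\<beta> j * k) :: nat)
      \<le> multiplicity p (\<Prod>i\<in>UNIV. fact (\<alpha> i * k) :: nat)"
    using int[of k] unfolding factorial_ratio_in_Ints_iff
    by (intro dvd_imp_multiplicity_le) auto
  ultimately show False by simp
qed

text \<open>For each prime, the multiplicity in the numerator minus that in the denominator is a sum
  of nonnegative values, so the denominator divides the numerator prime by prime.\<close>

lemma floor_diff_nonneg_imp_factorial_ratio_in_Ints:
  assumes "\<And>x. floor_diff \<alpha> \<beta> x \<ge> 0"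
  shows "factorial_ratio \<alpha> \<beta> k \<in> \<int>"
  unfolding factorial_ratio_in_Ints_iff
proof (rule multiplicity_le_imp_dvd)
  show "(\<Prod>j\<in>UNIV. fact (\<beta> j * k) :: nat) \<noteq> 0" by simp
next
  fix p :: nat assume "prime p"
  from multiplicity_factorial_products[OF this order.refl, of \<alpha> k \<beta>]
  show "multiplicity p (\<Prod>j\<in>UNIV. fact (\<beta> j * k) :: nat)
      \<le> multiplicity p (\<Prod>i\<in>UNIV. fact (\<alpha> i * k) :: nat)"
    using sum_nonneg[of _ "\<lambda>e. floor_diff \<alpha> \<beta> (real k / real (p ^ e))"] assms
    by (smt (verit) of_nat_le_iff)
qed

theorem landau_criterion:
  assumes "(\<Sum>i\<in>UNIV. \<alpha> i) = (\<Sum>j\<in>UNIV. \<beta> j)"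
  shows "(\<forall>k. factorial_ratio \<alpha> \<beta> k \<in> \<int>) \<longleftrightarrow> (\<forall>x. floor_diff \<alpha> \<beta> x \<ge> 0)"
  using factorial_ratio_in_Ints_imp_floor_diff_nonneg[OF assms]
    floor_diff_nonneg_imp_factorial_ratio_in_Ints[of \<alpha> \<beta>] by auto

section \<open>The dilated polytope and its interior as systems of inequalities\<close>

text \<open>For \<open>r = 1\<close>, \<open>s\<close> is the weight of \<open>v\<close>, the
  coordinates of \<open>x - s v\<close> are the weights of the unit vectors, and the origin takes
  the remaining weight. Since the coordinates of \<open>v\<close> sum to 0, these weights apart from
  that of the origin add up to the coordinate sum of \<open>x\<close> plus \<open>s\<close>. The
  general case follows by scaling \<open>x\<close> and \<open>s\<close>.\<close>

lemma dilate_convex_hull_apex: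
  fixes v :: "real ^ 'm::finite"
  assumes v: "(\<Sum>l\<in>UNIV. v $ l) = 0" and "r > 0"
  shows "dilate r (convex hull ({0} \<union> range (\<lambda>l. axis l 1) \<union> {v}))
    = {x. \<exists>s\<ge>0. (\<forall>l. s * v $ l \<le> x $ l) \<and> (\<Sum>l\<in>UNIV. x $ l) + s \<le> real r}"
    (is "dilate r (convex hull ?V) = ?T (real r)")
proof -
  have "?T 1 \<subseteq> convex hull ?V"
  proof
    fix x assume "x \<in> ?T 1"
    then obtain s where s: "s \<ge> 0" "\<And>l. s * v $ l \<le> x $ l" "(\<Sum>l\<in>UNIV. x $ l) + s \<le> 1"
      by blast
    \<comment> \<open>Barycentric weights: \<open>None\<close> stands for the origin,
      \<open>Some None\<close> for \<open>v\<close>, and \<open>Some (Some l)\<close> for a unit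
      vector. Indexing by a type avoids any question of whether vertices coincide.\<close>
    define a where "a = (\<lambda>q. case q of None \<Rightarrow> 1 - s - (\<Sum>l\<in>UNIV. x $ l)
      | Some None \<Rightarrow> s | Some (Some l) \<Rightarrow> x $ l - s * v $ l)"
    define y :: "'m option option \<Rightarrow> real ^ 'm" where
      "y = (\<lambda>q. case q of None \<Rightarrow> 0 | Some None \<Rightarrow> v | Some (Some l) \<Rightarrow> axis l 1)"
    have sum_option: "sum f UNIV = f None + (\<Sum>l\<in>UNIV. f (Some l))"
      for f :: "'b::finite option \<Rightarrow> 'c::comm_monoid_add"
      by (simp add: UNIV_option_conv sum.reindex)
    have "(\<Sum>q\<in>UNIV. a q *\<^sub>R y q) \<in> convex hull ?V"
    proof (rule convex_sum)
      show "(\<Sum>q\<in>UNIV. a q) = 1"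
        by (simp add: sum_option a_def sum_subtractf v flip: sum_distrib_left)
      show "0 \<le> a q" for q using s by (auto simp: a_def split: option.split)
      show "y q \<in> convex hull ?V" for q
        by (rule hull_inc) (auto simp: y_def split: option.split)
    qed auto
    also have "(\<Sum>q\<in>UNIV. a q *\<^sub>R y q) = x"
      by (simp add: sum_option a_def y_def vec_eq_iff axis_def if_distrib cong: if_cong)
    finally show "x \<in> convex hull ?V" .
  qed
  moreover have "convex hull ?V \<subseteq> ?T 1"
  proof (rule hull_minimal)
    have "0 \<in> ?T 1" by (auto intro!: exI[of _ 0])
    moreover have "axis l 1 \<in> ?T 1" for l by (auto intro!: exI[of _ 0] simp: axis_def)
    moreover have "v \<in> ?T 1" using v by (auto intro!: exI[of _ 1])
    ultimately show "?V \<subseteq> ?T 1" by blast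
    show "convex (?T 1)"
    proof (rule convexI)
      fix x y :: "real ^ 'm" and a b :: real
      assume ab: "0 \<le> a" "0 \<le> b" "a + b = 1"
      assume "x \<in> ?T 1" "y \<in> ?T 1"
      then obtain s t where s: "s \<ge> 0" "\<And>l. s * v $ l \<le> x $ l" "(\<Sum>l\<in>UNIV. x $ l) + s \<le> 1"
        and t: "t \<ge> 0" "\<And>l. t * v $ l \<le> y $ l" "(\<Sum>l\<in>UNIV. y $ l) + t \<le> 1"
        by blast
      have "(a * s + b * t) * v $ l \<le> (a *\<^sub>R x + b *\<^sub>R y) $ l" for l
        using mult_left_mono[OF s(2)[of l] ab(1)] mult_left_mono[OF t(2)[of l] ab(2)]
        by (simp add: algebra_simps)
      moreover have "(\<Sum>l\<in>UNIV. (a *\<^sub>R x + b *\<^sub>R y) $ l) + (a * s + b * t) \<le> 1"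
        using mult_left_mono[OF s(3) ab(1)] mult_left_mono[OF t(3) ab(2)] ab(3)
        by (simp add: sum.distrib algebra_simps flip: sum_distrib_left)
      moreover have "a * s + b * t \<ge> 0" using ab s t by simp
      ultimately show "a *\<^sub>R x + b *\<^sub>R y \<in> ?T 1" by blast
    qed
  qed
  ultimately have hull: "convex hull ?V = ?T 1" by blast
  have "x \<in> dilate r (?T 1) \<longleftrightarrow> x \<in> ?T (real r)" for x
  proof
    assume "x \<in> dilate r (?T 1)"
    then obtain y s where y: "x = real r *\<^sub>R y" and s: "s \<ge> 0" "\<And>l. s * v $ l \<le> y $ l"
      "(\<Sum>l\<in>UNIV. y $ l) + s \<le> 1" unfolding dilate_def by blast
    have "real r * s * v $ l \<le> x $ l" for l
      using mult_left_mono[OF s(2)[of l], of "real r"] by (simp add: y mult.assoc)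
    moreover have "(\<Sum>l\<in>UNIV. x $ l) + real r * s \<le> real r"
      using mult_left_mono[OF s(3), of "real r"]
      by (simp add: y distrib_left flip: sum_distrib_left)
    ultimately show "x \<in> ?T (real r)" using s(1) by (auto intro!: exI[of _ "real r * s"])
  next
    assume "x \<in> ?T (real r)"
    then obtain s where s: "s \<ge> 0" "\<And>l. s * v $ l \<le> x $ l"
      "(\<Sum>l\<in>UNIV. x $ l) + s \<le> real r" by blast
    have "s / r * v $ l \<le> (x /\<^sub>R real r) $ l" for l
      using s(2)[of l] \<open>r > 0\<close> by (simp add: field_simps)
    moreover have "(\<Sum>l\<in>UNIV. (x /\<^sub>R real r) $ l) + s / r \<le> 1"
      using s(3) \<open>r > 0\<close> by (simp add: field_simps flip: sum_distrib_left sum_divide_distrib)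
    moreover have "s / r \<ge> 0" using s(1) by simp
    ultimately have "x /\<^sub>R real r \<in> ?T 1" by blast
    then show "x \<in> dilate r (?T 1)"
      unfolding dilate_def by (rule rev_image_eqI) (use \<open>r > 0\<close> in simp)
  qed
  then show ?thesis unfolding hull by blast
qed

text \<open>The right-hand side is open, being a union over \<open>s\<close> of finite intersections
  of open half-spaces. As \<open>s\<close> is existentially quantified, the converse is not a matter
  of making single inequalities strict; it uses convexity and a point satisfying all of them
  strictly, which \<open>c > 0\<close> provides.\<close>

lemma interior_apex_region:
  fixes v :: "real ^ 'm::finite"
  assumes "c > 0"
  shows "interior {x. \<exists>s\<ge>0. (\<forall>l. s * v $ l \<le> x $ l) \<and> (\<Sum>l\<in>UNIV. x $ l) + s \<le> c}
    = {x. \<exists>s>0. (\<forall>l. s * v $ l < x $ l) \<and> (\<Sum>l\<in>UNIV. x $ l) + s < c}"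
    (is "interior ?T = ?U")
proof
  have "?U = (\<Union>s\<in>{0<..}. (\<Inter>l. {x. s * v $ l < x $ l}) \<inter> {x. (\<Sum>l\<in>UNIV. x $ l) + s < c})"
    by auto
  also have "open \<dots>"
    by (intro open_UN ballI open_Int open_INT open_Collect_less continuous_intros finite)
  finally have "open ?U" .
  then show "?U \<subseteq> interior ?T" by (intro interior_maximal) (auto intro: less_imp_le)
next
  show "interior ?T \<subseteq> ?U"
  proof
    fix x assume "x \<in> interior ?T"
    then obtain e where e: "e > 0" "ball x e \<subseteq> ?T" by (auto simp: mem_interior)
    \<comment> \<open>Push \<open>x\<close> slightly towards the outside, away from a point \<open>p\<close> of \<open>?U\<close>: the result \<open>y\<close> is
      still in \<open>?T\<close>, and \<open>x\<close> is a proper convex combination of \<open>y\<close> and \<open>p\<close>.\<close>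
    define V where "V = (\<Sum>l\<in>UNIV. v $ l)"
    \<comment> \<open>The point \<open>p\<close> below, with parameter \<open>d\<close>, exceeds
      \<open>d * v\<close> by \<open>d\<close> in every coordinate, and its coordinate sum plus
      \<open>d\<close> is \<open>d * (CARD('m) + 1 + V)\<close>. The choice of \<open>d\<close>
      makes this at most \<open>c / 2\<close>, whatever the sign of \<open>V\<close>.\<close>
    define d where "d = c / (2 * (real CARD('m) + 1 + \<bar>V\<bar>))"
    have den: "real CARD('m) + 1 + \<bar>V\<bar> > 0" by simp
    have d: "d > 0" using assms den by (simp add: d_def)
    have dc: "d * (real CARD('m) + 1 + \<bar>V\<bar>) < c"
      unfolding d_def using assms den by (subst times_divide_eq_left, subst pos_divide_less_eq) auto
    define p :: "real ^ 'm" where "p = (\<chi> l. d + d * v $ l)"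
    have "(\<Sum>l\<in>UNIV. p $ l) + d = d * (real CARD('m) + 1 + V)"
      by (simp add: p_def V_def sum.distrib algebra_simps flip: sum_distrib_left)
    also have "\<dots> \<le> d * (real CARD('m) + 1 + \<bar>V\<bar>)" using d by (intro mult_left_mono) auto
    finally have p: "(\<Sum>l\<in>UNIV. p $ l) + d < c" using dc by simp
    \<comment> \<open>Keeps \<open>h * norm (x - p)\<close> at most \<open>e / 2\<close>; the
      \<open>+ 1\<close> covers the case \<open>x = p\<close>.\<close>
    define h where "h = e / (2 * (norm (x - p) + 1))"
    have h: "h > 0" using e(1) by (simp add: h_def add_nonneg_pos)
    define y where "y = x + h *\<^sub>R (x - p)"
    have "h * norm (x - p) < e"
    proof -
      have "h * norm (x - p) \<le> h * (norm (x - p) + 1)" using h by simp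
      also have "\<dots> = e / 2" using norm_ge_zero[of "x - p"] by (simp add: h_def field_simps add_nonneg_eq_0_iff)
      finally show ?thesis using e(1) by simp
    qed
    then have "y \<in> ball x e" using h by (simp add: y_def dist_norm)
    then obtain s where s: "s \<ge> 0" "\<And>l. s * v $ l \<le> y $ l" "(\<Sum>l\<in>UNIV. y $ l) + s \<le> c"
      using e(2) by blast
    \<comment> \<open>\<open>x\<close> is the convex combination of \<open>y\<close> and
      \<open>p\<close> with weights proportional to 1 and \<open>h\<close>; \<open>t\<close>
      combines their parameters \<open>s\<close> and \<open>d\<close> in the same way, and the
      strictness comes from \<open>p\<close>.\<close>
    define t where "t = (s + h * d) / (1 + h)"
    have x: "x $ l = (y $ l + h * p $ l) / (1 + h)" for l
      using h by (simp add: y_def field_simps)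
    have "t > 0" using s(1) h d by (simp add: t_def add_nonneg_pos)
    moreover have "t * v $ l < x $ l" for l
    proof -
      have "(s + h * d) * v $ l < y $ l + h * p $ l"
        using s(2)[of l] mult_pos_pos[OF h d] by (simp add: p_def algebra_simps)
      then show ?thesis using h unfolding x t_def by (simp add: divide_strict_right_mono)
    qed
    moreover have "(\<Sum>l\<in>UNIV. x $ l) + t < c"
    proof -
      have "(\<Sum>l\<in>UNIV. x $ l) + t
          = (((\<Sum>l\<in>UNIV. y $ l) + s) + h * ((\<Sum>l\<in>UNIV. p $ l) + d)) / (1 + h)"
        by (simp add: x t_def sum.distrib add_divide_distrib algebra_simps
            flip: sum_divide_distrib sum_distrib_left)
      also have "\<dots> < (c + h * c) / (1 + h)"
        using add_le_less_mono[OF s(3) mult_strict_left_mono[OF p h]] h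
        by (intro divide_strict_right_mono) auto
      also have "\<dots> = c" using h by (simp add: field_simps)
      finally show ?thesis .
    qed
    ultimately show "x \<in> ?U" by blast
  qed
qed

lemma sum_UNIV_Plus:
  fixes f :: "'a::finite + 'b::finite \<Rightarrow> 'c::comm_monoid_add"
  shows "(\<Sum>l\<in>UNIV. f l) = (\<Sum>i\<in>UNIV. f (Inl i)) + (\<Sum>j\<in>UNIV. f (Inr j))"
  unfolding UNIV_Plus_UNIV[symmetric] by (simp add: sum.Plus del: UNIV_Plus_UNIV)

text \<open>The equality of the two sums says that the apex has coordinate sum 0, so both preceding
  descriptions apply; only the coordinates remain to be split into the two blocks.\<close>

lemma interior_Delta_polytope:
  fixes \<alpha> :: "'n::finite \<Rightarrow> nat" and \<beta> :: "'p::finite \<Rightarrow> nat"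
  assumes "(\<Sum>i\<in>UNIV. \<alpha> i) = (\<Sum>j\<in>UNIV. \<beta> j)" and "r > 0"
  shows "interior (dilate r (Delta_polytope \<alpha> \<beta>))
    = {x. \<exists>s>0. (\<forall>i. s * real (\<alpha> i) < x $ Inl i) \<and> (\<forall>j. - (s * real (\<beta> j)) < x $ Inr j)
        \<and> (\<Sum>i\<in>UNIV. x $ Inl i) + (\<Sum>j\<in>UNIV. x $ Inr j) + s < real r}"
proof -
  have "(\<Sum>i\<in>UNIV. real (\<alpha> i)) = (\<Sum>j\<in>UNIV. real (\<beta> j))"
    using assms(1) by (metis of_nat_sum)
  then have apex: "(\<Sum>l\<in>UNIV. apex \<alpha> \<beta> $ l) = 0"
    by (simp add: sum_UNIV_Plus apex_def sum_negf)
  have all: "(\<forall>l. P l) \<longleftrightarrow> (\<forall>i. P (Inl i)) \<and> (\<forall>j. P (Inr j))" for P :: "'n + 'p \<Rightarrow> bool"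
    by (metis sum.exhaust)
  have "real r > 0" using assms(2) by simp
  then show ?thesis
    unfolding Delta_polytope_def dilate_convex_hull_apex[OF apex assms(2)]
    by (subst interior_apex_region) (simp_all add: all sum_UNIV_Plus apex_def conj_assoc)
qed

section \<open>Interior lattice points and negative values of Landau's function\<close>

lemma interior_lattice_point_iff:
  fixes \<alpha> :: "'n::finite \<Rightarrow> nat" and \<beta> :: "'p::finite \<Rightarrow> nat"
  assumes \<beta>: "\<And>j. \<beta> j > 0" and sums: "(\<Sum>i\<in>UNIV. \<alpha> i) = (\<Sum>j\<in>UNIV. \<beta> j)"
  shows "interior (dilate CARD('n) (Delta_polytope \<alpha> \<beta>)) \<inter> lattice_points \<noteq> {}
    \<longleftrightarrow> (\<exists>s. floor_diff \<alpha> \<beta> s < 0)"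
proof
  assume "interior (dilate CARD('n) (Delta_polytope \<alpha> \<beta>)) \<inter> lattice_points \<noteq> {}"
  then obtain x s where x: "\<And>l. x $ l \<in> \<int>" and s: "s > 0"
    and xa: "\<And>i. s * real (\<alpha> i) < x $ Inl i" and xb: "\<And>j. - (s * real (\<beta> j)) < x $ Inr j"
    and xs: "(\<Sum>i\<in>UNIV. x $ Inl i) + (\<Sum>j\<in>UNIV. x $ Inr j) + s < real CARD('n)"
    by (auto simp: interior_Delta_polytope[OF sums zero_less_card_finite] lattice_points_def)
  \<comment> \<open>Just left of \<open>s\<close>, the floor of \<open>\<beta> j * t\<close> is the
    largest integer strictly below \<open>\<beta> j * s\<close>, hence an upper bound for the
    integer \<open>- x $ Inr j\<close>.\<close>
  have "eventually (\<lambda>t. \<forall>j. \<lfloor>real (\<beta> j) * t\<rfloor> = \<lceil>real (\<beta> j) * s\<rceil> - 1) (at_left s)"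
    using \<beta> by (intro eventually_all_finite eventually_floor_at_left)
  moreover have "eventually (\<lambda>t. t < s) (at_left s)"
    by (simp add: eventually_at_filter)
  ultimately have "eventually (\<lambda>t. t < s \<and> (\<forall>j. \<lfloor>real (\<beta> j) * t\<rfloor> = \<lceil>real (\<beta> j) * s\<rceil> - 1)) (at_left s)"
    by eventually_elim blast
  then obtain t where t: "t < s" "\<And>j. \<lfloor>real (\<beta> j) * t\<rfloor> = \<lceil>real (\<beta> j) * s\<rceil> - 1"
    using eventually_happens'[OF trivial_limit_at_left_real] by blast
  have "of_int \<lfloor>real (\<alpha> i) * t\<rfloor> \<le> x $ Inl i - 1" for i
  proof -
    obtain z where z: "x $ Inl i = of_int z" using x[of "Inl i"] by (elim Ints_cases)
    have "real (\<alpha> i) * t \<le> real (\<alpha> i) * s" using t(1) by (simp add: mult_left_mono)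
    then have "\<lfloor>real (\<alpha> i) * t\<rfloor> < z" using xa[of i] unfolding z by (simp add: floor_less_iff mult.commute)
    then have "\<lfloor>real (\<alpha> i) * t\<rfloor> \<le> z - 1" by simp
    then show ?thesis unfolding z by linarith
  qed
  then have "(\<Sum>i\<in>UNIV. of_int \<lfloor>real (\<alpha> i) * t\<rfloor>) \<le> (\<Sum>i\<in>UNIV. x $ Inl i - 1)"
    by (rule sum_mono)
  moreover have "- x $ Inr j \<le> of_int \<lfloor>real (\<beta> j) * t\<rfloor>" for j
  proof -
    obtain z where z: "x $ Inr j = of_int z" using x[of "Inr j"] by (elim Ints_cases)
    have "- z < \<lceil>real (\<beta> j) * s\<rceil>" using xb[of j] unfolding z by (simp add: less_ceiling_iff mult.commute)
    then have "- z \<le> \<lceil>real (\<beta> j) * s\<rceil> - 1" by simp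
    then show ?thesis unfolding z t(2) by linarith
  qed
  then have "(\<Sum>j\<in>UNIV. - x $ Inr j) \<le> (\<Sum>j\<in>UNIV. of_int \<lfloor>real (\<beta> j) * t\<rfloor>)"
    by (rule sum_mono)
  \<comment> \<open>Each of the \<open>CARD('n)\<close> strict inequalities at the \<alpha>
    coordinates gains 1 by integrality, so the value at \<open>t\<close> is at most the coordinate
    sum of \<open>x\<close> minus \<open>CARD('n)\<close>, which is below
    \<open>- s\<close>.\<close>
  ultimately have "of_int (floor_diff \<alpha> \<beta> t) < (0::real)"
    using xs s by (simp add: floor_diff_def sum_subtractf sum_negf)
  then show "\<exists>s. floor_diff \<alpha> \<beta> s < 0" by auto
next
  assume "\<exists>s. floor_diff \<alpha> \<beta> s < 0"
  then obtain s0 where "floor_diff \<alpha> \<beta> s0 < 0" by blast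
  define s where "s = frac s0"
  have neg: "floor_diff \<alpha> \<beta> s < 0"
    using \<open>floor_diff \<alpha> \<beta> s0 < 0\<close> by (simp add: s_def floor_diff_frac[OF sums])
  have "s \<noteq> 0" using neg by (auto simp: floor_diff_def)
  then have s: "0 < s" "s < 1" using frac_lt_1[of s0] by (auto simp: s_def)
  \<comment> \<open>Moving slightly to the right makes all \<open>\<beta> j * t\<close> strictly larger than their floors.\<close>
  have "eventually (\<lambda>t. \<forall>j. \<lfloor>real (\<beta> j) * t\<rfloor> = \<lfloor>real (\<beta> j) * s\<rfloor>) (at_right s)"
    by (intro eventually_all_finite eventually_floor_at_right)
  \<comment> \<open>The bound \<open>t < 1\<close> matters at the end: a negative integer value
    lowers the coordinate sum to at most \<open>CARD('n) - 1\<close>, which leaves room for adding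
    \<open>t\<close>.\<close>
  moreover have "eventually (\<lambda>t. t \<in> {s<..<1}) (at_right s)"
    using s(2) by (rule eventually_at_right_real)
  moreover note eventually_floor_diff_at_right[of \<alpha> \<beta> s]
  ultimately have "eventually (\<lambda>t. (\<forall>j. \<lfloor>real (\<beta> j) * t\<rfloor> = \<lfloor>real (\<beta> j) * s\<rfloor>) \<and> t \<in> {s<..<1}
      \<and> floor_diff \<alpha> \<beta> t = floor_diff \<alpha> \<beta> s) (at_right s)"
    by eventually_elim blast
  then obtain t where t: "\<And>j. \<lfloor>real (\<beta> j) * t\<rfloor> = \<lfloor>real (\<beta> j) * s\<rfloor>" "s < t" "t < 1"
      "floor_diff \<alpha> \<beta> t = floor_diff \<alpha> \<beta> s"
    using eventually_happens'[OF trivial_limit_at_right_real] by force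
  \<comment> \<open>Each coordinate is the least integer strictly above that of \<open>t\<close>
    times the apex. In the \<beta> block this is \<open>- \<lfloor>\<beta> j * t\<rfloor>\<close>
    because \<open>\<beta> j * t\<close> is not an integer, its floor being at most
    \<open>\<beta> j * s < \<beta> j * t\<close> and \<open>t\<close> lying close enough to
    \<open>s\<close>.\<close>
  define x :: "real ^ ('n + 'p)" where
    "x = (\<chi> l. case l of Inl i \<Rightarrow> of_int (\<lfloor>real (\<alpha> i) * t\<rfloor> + 1) | Inr j \<Rightarrow> of_int (- \<lfloor>real (\<beta> j) * t\<rfloor>))"
  have "x \<in> lattice_points"
    unfolding lattice_points_def x_def by (auto split: sum.split)
  moreover have "x \<in> interior (dilate CARD('n) (Delta_polytope \<alpha> \<beta>))"
  proof -
    have "t * real (\<alpha> i) < x $ Inl i" for i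
      by (simp add: x_def mult.commute)
    moreover have "- (t * real (\<beta> j)) < x $ Inr j" for j
    proof -
      have "of_int \<lfloor>real (\<beta> j) * s\<rfloor> \<le> real (\<beta> j) * s" by simp
      also have "\<dots> < real (\<beta> j) * t" using t(2) \<beta> by simp
      finally show ?thesis unfolding t(1)[of j, symmetric] by (simp add: x_def mult.commute)
    qed
    moreover have "(\<Sum>i\<in>UNIV. x $ Inl i) + (\<Sum>j\<in>UNIV. x $ Inr j) + t < real CARD('n)"
    proof -
      have "(\<Sum>i\<in>UNIV. x $ Inl i) + (\<Sum>j\<in>UNIV. x $ Inr j) = of_int (floor_diff \<alpha> \<beta> t) + real CARD('n)"
        by (simp add: x_def floor_diff_def sum.distrib sum_negf)
      moreover have "floor_diff \<alpha> \<beta> t \<le> - 1" using neg t(4) by simp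
      then have "real_of_int (floor_diff \<alpha> \<beta> t) \<le> - 1" by linarith
      ultimately show ?thesis using t(3) by linarith
    qed
    moreover have "t > 0" using s(1) t(2) by simp
    ultimately show ?thesis
      unfolding interior_Delta_polytope[OF sums zero_less_card_finite] by blast
  qed
  ultimately show "interior (dilate CARD('n) (Delta_polytope \<alpha> \<beta>)) \<inter> lattice_points \<noteq> {}"
    by blast
qed

theorem proposition1p3:
  fixes \<alpha> :: "'n::finite \<Rightarrow> nat" and \<beta> :: "'p::finite \<Rightarrow> nat"
  assumes "\<And>i. \<alpha> i > 0" and "\<And>j. \<beta> j > 0"
    and "(\<Sum>i\<in>UNIV. \<alpha> i) = (\<Sum>j\<in>UNIV. \<beta> j)"
  shows "(\<forall>k::nat. factorial_ratio \<alpha> \<beta> k \<in> \<int>) \<longleftrightarrow>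
    interior (dilate CARD('n) (Delta_polytope \<alpha> \<beta>)) \<inter> lattice_points = {}"
  using landau_criterion[OF assms(3)] interior_lattice_point_iff[OF assms(2,3)]
  by (meson not_le)

end
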